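(* Let $P$ be a finite normal logic program, let $S\subseteq\mathrm{At}(P)$ be a strongly connected component of the positive dependency graph of $P$, and let $P_S=\bigcup_{a\in S}\mathrm{Def}(a,P)$ be the module of $P$ induced by $S$. Let $\mathrm{TOC}_S(P)$ be the tight ordered completion of $P$ relative to $S$ (defined in the context). 1. If $M\subseteq\mathrm{At}(P_S)$ is a stable model of $P_S$ for an input $I\subseteq\mathrm{At}(P_S)\setminus S$ and $\mathrm{lev}:M\cap S\to\mathbb{N}$ is the respective level ranking, then there is a DL-interpretation $\langle N,\tau\rangle$ satisfying $\mathrm{TOC}_S(P)$ with $\tau(z)=0$ such that $M=N\cap\mathrm{At}(P_S)$, $\tau(x_a)=\mathrm{lev}(a)$ for each $a\in M\cap S$, and $\tau(x_a)=|S|+1$ for each $a\in S\setminus M$. 2. If $\langle N,\tau\rangle$ is a DL-interpretation satisfying $\mathrm{TOC}_S(P)$, then $M=N\cap\mathrm{At}(P_S)$ is a stable model of $P_S$ for the input $I=N\cap(\mathrm{At}(P_S)\setminus S)$, and for each $a\in M\cap S$, $\mathrm{lev}(a)=\tau(x_a)-\tau(z)$ is the level rank of $a$ (with respect to $M$ and $I$).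
   Context: A normal logic program is a finite set of rules $r$ of the form $a\leftarrow b_1,\dots,b_n,\mathrm{not}\,c_1,\dots,\mathrm{not}\,c_m$ with propositional atoms; $\mathrm{head}(r)=a$, $B^+(r)=\{b_1,\dots,b_n\}$, $B^-(r)=\{c_1,\dots,c_m\}$. $\mathrm{At}(P)$ is the set of atoms occurring in $P$, and $\mathrm{Def}(a,P)=\{r\in P:\mathrm{head}(r)=a\}$. We write $a\to_P b$ if $b\in B^+(r)$ for some $r\in\mathrm{Def}(a,P)$; the positive dependency graph is $(\mathrm{At}(P),\to_P)$, and a strongly connected component (SCC) is a maximal set $S$ of atoms such that any two distinct atoms of $S$ are connected by directed paths in both directions. For an interpretation $M$ (a set of atoms), the reduct $P_S^M$ consists of $a\leftarrow B^+(r)$ for each $r\in P_S$ with $B^-(r)\cap M=\emptyset$. Atoms in $\mathrm{At}(P_S)\setminus S$ are input atoms. Given $I\subseteq\mathrm{At}(P_S)\setminus S$, define $T^0=I$ and $T^i=I\cup\{\mathrm{head}(r): r\in P_S^M,\ B^+(r)\subseteq T^{i-1}\}$ for $i\geq1$. $M\subseteq\mathrm{At}(P_S)$ is a stable model of $P_S$ for input $I$ iff $M\cap(\mathrm{At}(P_S)\setminus S)=I$ and $M=\bigcup_i T^i$ (the least model of $P_S^M\cup I$). The level ranking assigns to each $a\in M\cap S$ the least $i\geq1$ with $a\in T^i$. Difference logic (DL): formulas are propositional formulas over Boolean atoms whose atomic constituents may also be difference constraints $x-y\leq k$ over integer variables ($x>y$ abbreviates $y-x\leq-1$, etc.). A DL-interpretation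 $\langle N,\tau\rangle$ consists of a set $N$ of true Boolean atoms and an integer assignment $\tau$; $x-y\leq k$ holds iff $\tau(x)-\tau(y)\leq k$, and the connectives are evaluated classically. A special variable $z$ serves as reference point: constraints involving one variable are read relative to $z$ (e.g. $1\leq x_a$ means $z-x_a\leq-1$). $\mathrm{TOC}_S(P)$ uses integer variables $z$ and $x_a$ ($a\in S$), and new Boolean atoms $\mathrm{dep}_{a,b}$, $\mathrm{gap}_{a,b}$, $\mathrm{app}_r$, and consists of: (i) for each $a\in S$: $1\leq x_a-z\leq|S|+1$ and $\neg a\rightarrow(x_a-z\geq|S|+1)$; (ii) for all $a,b\in S$ with $a\to_P b$: $\mathrm{dep}_{a,b}\leftrightarrow b\wedge(x_a>x_b)$ and $\mathrm{gap}_{a,b}\leftrightarrow b\wedge(x_a>x_b+1)$; (iii) for each $a\in S$ with $\mathrm{Def}(a,P)=\{r_1,\dots,r_k\}$: $a\leftrightarrow \mathrm{app}_{r_1}\vee\dots\vee\mathrm{app}_{r_k}$; for each $i$: $\mathrm{app}_{r_i}\leftrightarrow\bigwedge_{b\in B^+(r_i)\cap S}\mathrm{dep}_{a,b}\wedge\bigwedge_{b\in B^+(r_i)\setminus S}b\wedge\bigwedge_{c\in B^-(r_i)}\neg c$; if $B^+(r_i)\cap S\neq\emptyset$: $\mathrm{app}_{r_i}\rightarrow\bigvee_{b\in B^+(r_i)\cap S}\neg\mathrm{gap}_{a,b}$; if $B^+(r_i)\cap S=\emptyset$: $\mathrm{app}_{r_i}\rightarrow(x_a-z\leq1)$. *)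

theory Defs
  imports Main "HOL-Library.FSet"
begin

section \<open>Normal logic programs\<close>

datatype 'a rule = Rule (head: 'a) (pos: "'a fset") (neg: "'a fset")

type_synonym 'a program = "'a rule fset"

definition At :: "'a program \<Rightarrow> 'a set" where
  "At P = (\<Union>r\<in>fset P. {head r} \<union> fset (pos r) \<union> fset (neg r))"

definition Def :: "'a \<Rightarrow> 'a program \<Rightarrow> 'a program" where
  "Def a P = ffilter (\<lambda>r. head r = a) P"

definition pos_dep :: "'a program \<Rightarrow> 'a \<Rightarrow> 'a \<Rightarrow> bool" where
  "pos_dep P a b \<longleftrightarrow> (\<exists>r. r |\<in>| Def a P \<and> b |\<in>| pos r)"

definition strongly_connected :: "'a program \<Rightarrow> 'a set \<Rightarrow> bool" where
  "strongly_connected P S \<longleftrightarrow>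
     S \<subseteq> At P \<and> (\<forall>a\<in>S. \<forall>b\<in>S. a \<noteq> b \<longrightarrow> (pos_dep P)\<^sup>+\<^sup>+ a b \<and> (pos_dep P)\<^sup>+\<^sup>+ b a)"

definition is_scc :: "'a program \<Rightarrow> 'a set \<Rightarrow> bool" where
  "is_scc P S \<longleftrightarrow>
     strongly_connected P S \<and> (\<forall>S'. strongly_connected P S' \<and> S \<subseteq> S' \<longrightarrow> S' = S)"

text \<open>The module \<open>P\<^sub>S\<close>. Filtering keeps the result a finite set by construction, also when
  \<open>S\<close> is an arbitrary set; the lemma below gives it as a union of definitions.\<close>

definition module_of :: "'a program \<Rightarrow> 'a set \<Rightarrow> 'a program" where
  "module_of P S = ffilter (\<lambda>r. head r \<in> S) P"

lemma fset_module_of: "fset (module_of P S) = (\<Union>a\<in>S. fset (Def a P))"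
  by (auto simp: module_of_def Def_def)

definition reduct :: "'a program \<Rightarrow> 'a set \<Rightarrow> 'a program" where
  "reduct Q M = (\<lambda>r. Rule (head r) (pos r) {||}) |`| ffilter (\<lambda>r. fset (neg r) \<inter> M = {}) Q"

primrec stage :: "'a program \<Rightarrow> 'a set \<Rightarrow> nat \<Rightarrow> 'a set" where
  "stage Q I 0 = I"
| "stage Q I (Suc i) = I \<union> {head r | r. r |\<in>| Q \<and> fset (pos r) \<subseteq> stage Q I i}"

definition input_atoms :: "'a program \<Rightarrow> 'a set \<Rightarrow> 'a set" where
  "input_atoms P S = At (module_of P S) - S"

definition stable_model :: "'a program \<Rightarrow> 'a set \<Rightarrow> 'a set \<Rightarrow> 'a set \<Rightarrow> bool" where
  "stable_model P S I M \<longleftrightarrow>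
     I \<subseteq> input_atoms P S \<and> M \<subseteq> At (module_of P S) \<and>
     M \<inter> input_atoms P S = I \<and>
     M = (\<Union>i. stage (reduct (module_of P S) M) I i)"

text \<open>Only meaningful for \<open>a \<in> M \<inter> S\<close> where \<open>M\<close> is a stable model for input \<open>I\<close>;
  elsewhere no such \<open>i\<close> need exist.\<close>

definition level_rank :: "'a program \<Rightarrow> 'a set \<Rightarrow> 'a set \<Rightarrow> 'a set \<Rightarrow> 'a \<Rightarrow> nat" where
  "level_rank P S I M a = (LEAST i. 1 \<le> i \<and> a \<in> stage (reduct (module_of P S) M) I i)"


section \<open>Difference logic\<close>

text \<open>\<open>Diff x y k\<close> is the constraint \<open>x - y \<le> k\<close>.\<close>

datatype ('b, 'v) dl_form =
    Atom 'b
  | Diff 'v 'v int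
  | Neg "('b, 'v) dl_form"
  | And "('b, 'v) dl_form" "('b, 'v) dl_form"
  | Imp "('b, 'v) dl_form" "('b, 'v) dl_form"
  | Iff "('b, 'v) dl_form" "('b, 'v) dl_form"
  | Conj "('b, 'v) dl_form fset"
  | Disj "('b, 'v) dl_form fset"

primrec dl_sat :: "'b set \<Rightarrow> ('v \<Rightarrow> int) \<Rightarrow> ('b, 'v) dl_form \<Rightarrow> bool" where
  "dl_sat N \<tau> (Atom b) \<longleftrightarrow> b \<in> N"
| "dl_sat N \<tau> (Diff x y k) \<longleftrightarrow> \<tau> x - \<tau> y \<le> k"
| "dl_sat N \<tau> (Neg \<phi>) \<longleftrightarrow> \<not> dl_sat N \<tau> \<phi>"
| "dl_sat N \<tau> (And \<phi> \<psi>) \<longleftrightarrow> dl_sat N \<tau> \<phi> \<and> dl_sat N \<tau> \<psi>"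
| "dl_sat N \<tau> (Imp \<phi> \<psi>) \<longleftrightarrow> (dl_sat N \<tau> \<phi> \<longrightarrow> dl_sat N \<tau> \<psi>)"
| "dl_sat N \<tau> (Iff \<phi> \<psi>) \<longleftrightarrow> (dl_sat N \<tau> \<phi> \<longleftrightarrow> dl_sat N \<tau> \<psi>)"
| "dl_sat N \<tau> (Conj \<Phi>) \<longleftrightarrow> (\<forall>v\<in>fset (dl_sat N \<tau> |`| \<Phi>). v)"
| "dl_sat N \<tau> (Disj \<Phi>) \<longleftrightarrow> (\<exists>v\<in>fset (dl_sat N \<tau> |`| \<Phi>). v)"

lemma dl_sat_Conj: "dl_sat N \<tau> (Conj \<Phi>) \<longleftrightarrow> (\<forall>\<phi>\<in>fset \<Phi>. dl_sat N \<tau> \<phi>)"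
  by simp

lemma dl_sat_Disj: "dl_sat N \<tau> (Disj \<Phi>) \<longleftrightarrow> (\<exists>\<phi>\<in>fset \<Phi>. dl_sat N \<tau> \<phi>)"
  by simp

definition dl_models :: "'b set \<Rightarrow> ('v \<Rightarrow> int) \<Rightarrow> ('b, 'v) dl_form set \<Rightarrow> bool" where
  "dl_models N \<tau> \<Gamma> \<longleftrightarrow> (\<forall>\<phi>\<in>\<Gamma>. dl_sat N \<tau> \<phi>)"

text \<open>\<open>x - y \<ge> k\<close> is \<open>y - x \<le> -k\<close>; hence \<open>x > y + k\<close> is \<open>Diff_ge x y (k + 1)\<close>.\<close>

abbreviation Diff_ge :: "'v \<Rightarrow> 'v \<Rightarrow> int \<Rightarrow> ('b, 'v) dl_form" where
  "Diff_ge x y k \<equiv> Diff y x (- k)"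

abbreviation Gt_plus :: "'v \<Rightarrow> 'v \<Rightarrow> int \<Rightarrow> ('b, 'v) dl_form" where
  "Gt_plus x y k \<equiv> Diff_ge x y (k + 1)"


section \<open>Tight ordered completion\<close>

text \<open>The atoms of the program are embedded by \<open>Orig\<close>, which makes the
  auxiliary atoms new by construction.\<close>

datatype 'a batom = Orig 'a | Dep 'a 'a | Gap 'a 'a | App "'a rule"

datatype 'a ivar = ZVar | XVar 'a

type_synonym 'a toc_form = "('a batom, 'a ivar) dl_form"

definition toc_range :: "'a set \<Rightarrow> 'a \<Rightarrow> 'a toc_form set" where
  "toc_range S a =
     {And (Diff_ge (XVar a) ZVar 1) (Diff (XVar a) ZVar (int (card S) + 1)),
      Imp (Neg (Atom (Orig a))) (Diff_ge (XVar a) ZVar (int (card S) + 1))}"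

definition toc_order :: "'a \<Rightarrow> 'a \<Rightarrow> 'a toc_form set" where
  "toc_order a b =
     {Iff (Atom (Dep a b)) (And (Atom (Orig b)) (Gt_plus (XVar a) (XVar b) 0)),
      Iff (Atom (Gap a b)) (And (Atom (Orig b)) (Gt_plus (XVar a) (XVar b) 1))}"

definition toc_support :: "'a program \<Rightarrow> 'a \<Rightarrow> 'a toc_form" where
  "toc_support P a = Iff (Atom (Orig a)) (Disj ((\<lambda>r. Atom (App r)) |`| Def a P))"

definition pos_in :: "'a set \<Rightarrow> 'a rule \<Rightarrow> 'a fset" where
  "pos_in S r = ffilter (\<lambda>b. b \<in> S) (pos r)"

definition pos_out :: "'a set \<Rightarrow> 'a rule \<Rightarrow> 'a fset" where
  "pos_out S r = ffilter (\<lambda>b. b \<notin> S) (pos r)"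

definition toc_app :: "'a set \<Rightarrow> 'a \<Rightarrow> 'a rule \<Rightarrow> 'a toc_form" where
  "toc_app S a r =
     Iff (Atom (App r))
       (And (Conj ((\<lambda>b. Atom (Dep a b)) |`| pos_in S r))
       (And (Conj ((\<lambda>b. Atom (Orig b)) |`| pos_out S r))
            (Conj ((\<lambda>c. Neg (Atom (Orig c))) |`| neg r))))"

definition toc_tight :: "'a set \<Rightarrow> 'a \<Rightarrow> 'a rule \<Rightarrow> 'a toc_form" where
  "toc_tight S a r =
     (if pos_in S r \<noteq> {||}
      then Imp (Atom (App r)) (Disj ((\<lambda>b. Neg (Atom (Gap a b))) |`| pos_in S r))
      else Imp (Atom (App r)) (Diff (XVar a) ZVar 1))"

definition TOC :: "'a program \<Rightarrow> 'a set \<Rightarrow> 'a toc_form set" where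
  "TOC P S =
     (\<Union>a\<in>S. toc_range S a)
   \<union> (\<Union>a\<in>S. \<Union>b\<in>{b\<in>S. pos_dep P a b}. toc_order a b)
   \<union> (\<Union>a\<in>S. {toc_support P a} \<union> (\<Union>r\<in>fset (Def a P). {toc_app S a r, toc_tight S a r}))"

end

theory Submission
  imports Defs
begin

text \<open>Eliminating the auxiliary atoms, a model of the tight ordered completion amounts to a
  set \<open>X\<close> of atoms together with a ranking \<open>m\<close> of \<open>S\<close> under which every atom of \<open>X\<close> in \<open>S\<close> is
  the head of a rule whose body holds and has smaller ranks, while every such rule has a body
  atom of rank at most one below its head. The level ranking has these properties: it has no
  gaps, so the rank \<open>card S + 1\<close> is free for the false atoms. Conversely, such an \<open>m\<close> takes all
  values from 1 to its maximum on \<open>X \<inter> S\<close>, so true atoms have rank at most \<open>card S\<close>. Hence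
  an atom derived at some stage cannot be false, since then its rank would exceed those of the
  body of the deriving rule, which would therefore support it. Induction on
  ranks and on stages then identifies \<open>m\<close> with the level ranking.\<close>

text \<open>Descending from \<open>a\<close> in steps of one reaches every value in
  \<open>{1..f a}\<close> without leaving \<open>A\<close>, so \<open>f\<close> takes at least
  \<open>f a\<close> distinct values on \<open>A\<close>.\<close>

lemma rank_le_card_if_gap_free:
  fixes f :: "'a \<Rightarrow> nat"
  assumes "finite A" "a \<in> A"
    and gap_free: "\<And>a. a \<in> A \<Longrightarrow> 2 \<le> f a \<Longrightarrow> \<exists>b\<in>A. f a = Suc (f b)"
  shows "f a \<le> card A"
proof -
  have "{1..f a} \<subseteq> f ` A" if "a \<in> A" for a
    using that
  proof (induction "f a" arbitrary: a)
    case 0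
    then show ?case by simp
  next
    case (Suc n)
    show ?case
    proof (cases "2 \<le> f a")
      case True
      then obtain b where b: "b \<in> A" "f a = Suc (f b)"
        using gap_free Suc.prems by blast
      then have "{1..f b} \<subseteq> f ` A"
        using Suc.hyps by simp
      moreover have "{1..f a} = insert (f a) {1..f b}"
        using b by auto
      ultimately show ?thesis
        using Suc.prems by auto
    next
      case False
      then have "f a = 1"
        using Suc.hyps by simp
      then show ?thesis
        using Suc.prems by force
    qed
  qed
  then have "card {1..f a} \<le> card (f ` A)"
    using assms by (intro card_mono) auto
  also have "\<dots> \<le> card A"
    using assms by (intro card_image_le)
  finally show ?thesis by simp
qed

lemma finite_At: "finite (At P)"
  by (simp add: At_def)

section \<open>Stages of the reduct\<close>

lemma stage_reduct_Suc_iff: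
  "a \<in> stage (reduct Q M) I (Suc i) \<longleftrightarrow>
     a \<in> I \<or> (\<exists>r. r |\<in>| Q \<and> head r = a \<and> fset (neg r) \<inter> M = {} \<and>
                  fset (pos r) \<subseteq> stage (reduct Q M) I i)"
  by (fastforce simp: reduct_def)

lemma stage_mono:
  assumes "a \<in> stage Q I i" "i \<le> j"
  shows "a \<in> stage Q I j"
proof -
  have "stage Q I i \<subseteq> stage Q I (Suc i)" for i
    by (induction i) auto
  then have "stage Q I i \<subseteq> stage Q I j"
    using assms(2) by (rule lift_Suc_mono_le)
  then show ?thesis
    using assms(1) by blast
qed

text \<open>All heads of module rules lie in \<open>S\<close>, so nothing outside \<open>S\<close>
  is ever derived beyond the input.\<close>

lemma stage_module_outside:
  assumes "a \<in> stage (reduct (module_of P S) M) I i" "a \<notin> S"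
  shows "a \<in> I"
  using assms by (cases i) (auto simp: stage_reduct_Suc_iff module_of_def simp del: stage.simps(2))

lemma level_rank_le:
  assumes "a \<in> stage (reduct (module_of P S) M) I i" "1 \<le> i"
  shows "level_rank P S I M a \<le> i"
  unfolding level_rank_def using assms by (intro Least_le) simp

lemma level_rank_stage:
  assumes "a \<in> stage (reduct (module_of P S) M) I i"
  shows "1 \<le> level_rank P S I M a"
    and "a \<in> stage (reduct (module_of P S) M) I (level_rank P S I M a)"
proof -
  \<comment> \<open>\<open>level_rank\<close> minimises over stages from 1 on, whereas
    \<open>i\<close> may be 0; the next stage is always an admissible witness.\<close>
  have "1 \<le> Suc i \<and> a \<in> stage (reduct (module_of P S) M) I (Suc i)"
    using stage_mono[OF assms, of "Suc i"] by simp
  then have "1 \<le> level_rank P S I M a \<and>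
      a \<in> stage (reduct (module_of P S) M) I (level_rank P S I M a)"
    unfolding level_rank_def by (rule LeastI)
  then show "1 \<le> level_rank P S I M a"
    and "a \<in> stage (reduct (module_of P S) M) I (level_rank P S I M a)"
    by auto
qed

section \<open>Tight rankings\<close>

text \<open>For a rule of \<open>P\<close> with head in \<open>S\<close>, this is what
  \<open>App r\<close> means in a model of \<open>TOC P S\<close> once the \<open>Dep\<close> atoms
  are unfolded.\<close>

definition rank_applicable :: "'a set \<Rightarrow> 'a set \<Rightarrow> ('a \<Rightarrow> nat) \<Rightarrow> 'a rule \<Rightarrow> bool" where
  "rank_applicable S X m r \<longleftrightarrow>
     (\<forall>b\<in>fset (pos r). b \<in> X \<and> (b \<in> S \<longrightarrow> m b < m (head r))) \<and> fset (neg r) \<inter> X = {}"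

text \<open>Meant for applicable rules: their positive body atoms are true, so the negation of
  \<open>Gap\<close> reduces to a comparison of ranks.\<close>

definition tight_at :: "'a set \<Rightarrow> ('a \<Rightarrow> nat) \<Rightarrow> 'a rule \<Rightarrow> bool" where
  "tight_at S m r \<longleftrightarrow>
     (if fset (pos r) \<inter> S = {} then m (head r) \<le> 1
      else \<exists>b\<in>fset (pos r) \<inter> S. m (head r) \<le> Suc (m b))"

definition tight_ranking :: "'a program \<Rightarrow> 'a set \<Rightarrow> 'a set \<Rightarrow> ('a \<Rightarrow> nat) \<Rightarrow> bool" where
  "tight_ranking P S X m \<longleftrightarrow>
     (\<forall>a\<in>S. 1 \<le> m a \<and> m a \<le> card S + 1 \<and> (a \<notin> X \<longrightarrow> m a = card S + 1)) \<and>
     (\<forall>a\<in>S. a \<in> X \<longleftrightarrow> (\<exists>r. r |\<in>| P \<and> head r = a \<and> rank_applicable S X m r)) \<and>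
     (\<forall>r. r |\<in>| P \<longrightarrow> head r \<in> S \<longrightarrow> rank_applicable S X m r \<longrightarrow> tight_at S m r)"

text \<open>The range formulas make the differences at least 1, so \<open>nat\<close> truncates
  nothing on \<open>S\<close>; the second conclusion keeps this fact for recovering the integer
  values.\<close>

lemma tight_ranking_if_models:
  assumes "dl_models N \<tau> (TOC P S)"
  shows "tight_ranking P S (Orig -` N) (\<lambda>a. nat (\<tau> (XVar a) - \<tau> ZVar))"
    and "\<And>a. a \<in> S \<Longrightarrow> \<tau> ZVar < \<tau> (XVar a)"
proof -
  let ?m = "\<lambda>a. nat (\<tau> (XVar a) - \<tau> ZVar)"
  have range: "1 \<le> \<tau> (XVar a) - \<tau> ZVar" "\<tau> (XVar a) - \<tau> ZVar \<le> int (card S) + 1"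
    "Orig a \<notin> N \<Longrightarrow> \<tau> (XVar a) - \<tau> ZVar \<ge> int (card S) + 1" if "a \<in> S" for a
  proof -
    have "\<forall>\<phi>\<in>toc_range S a. dl_sat N \<tau> \<phi>"
      using assms that unfolding dl_models_def TOC_def by blast
    then show "1 \<le> \<tau> (XVar a) - \<tau> ZVar" "\<tau> (XVar a) - \<tau> ZVar \<le> int (card S) + 1"
      "Orig a \<notin> N \<Longrightarrow> \<tau> (XVar a) - \<tau> ZVar \<ge> int (card S) + 1"
      by (auto simp: toc_range_def)
  qed
  then show "\<And>a. a \<in> S \<Longrightarrow> \<tau> ZVar < \<tau> (XVar a)"
    by force
  have order: "Dep (head r) b \<in> N \<longleftrightarrow> Orig b \<in> N \<and> ?m b < ?m (head r)"
    "Gap (head r) b \<in> N \<longleftrightarrow> Orig b \<in> N \<and> Suc (?m b) < ?m (head r)"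
    if "head r \<in> S" "b \<in> S" "r |\<in>| P" "b |\<in>| pos r" for r b
  proof -
    \<comment> \<open>\<open>TOC P S\<close> constrains \<open>Dep\<close> and \<open>Gap\<close>
      along dependency edges only; the rule \<open>r\<close> provides the edge.\<close>
    have "pos_dep P (head r) b"
      using that by (auto simp: pos_dep_def Def_def)
    then have "\<forall>\<phi>\<in>toc_order (head r) b. dl_sat N \<tau> \<phi>"
      using assms that unfolding dl_models_def TOC_def by blast
    then show "Dep (head r) b \<in> N \<longleftrightarrow> Orig b \<in> N \<and> ?m b < ?m (head r)"
      "Gap (head r) b \<in> N \<longleftrightarrow> Orig b \<in> N \<and> Suc (?m b) < ?m (head r)"
      using range(1)[of b] range(1)[of "head r"] that by (auto simp: toc_order_def)
  qed
  have rules: "dl_sat N \<tau> (toc_app S (head r) r)" "dl_sat N \<tau> (toc_tight S (head r) r)"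
    if "head r \<in> S" "r |\<in>| P" for r
  proof -
    have "r \<in> fset (Def (head r) P)"
      using that by (simp add: Def_def)
    then show "dl_sat N \<tau> (toc_app S (head r) r)" "dl_sat N \<tau> (toc_tight S (head r) r)"
      using assms that unfolding dl_models_def TOC_def by blast+
  qed
  have app: "App r \<in> N \<longleftrightarrow> rank_applicable S (Orig -` N) ?m r"
    if "head r \<in> S" "r |\<in>| P" for r
    using rules(1)[OF that] order(1)[OF that(1) _ that(2)]
    unfolding toc_app_def rank_applicable_def pos_in_def pos_out_def
    by (auto simp del: zless_nat_conj nat_less_eq_zless)
  have "tight_at S ?m r" if "head r \<in> S" "r |\<in>| P" "rank_applicable S (Orig -` N) ?m r" for r
  proof (cases "fset (pos r) \<inter> S = {}")
    case True
    then have "pos_in S r = {||}"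
      by (auto simp: pos_in_def)
    then show ?thesis
      using True rules(2)[OF that(1,2)] app[OF that(1,2)] that(3)
      by (auto simp: toc_tight_def tight_at_def)
  next
    case False
    then have "pos_in S r \<noteq> {||}"
      by (auto simp: pos_in_def)
    then have "\<exists>b\<in>fset (pos r) \<inter> S. Gap (head r) b \<notin> N"
      using rules(2)[OF that(1,2)] app[OF that(1,2)] that(3)
      by (auto simp: toc_tight_def pos_in_def)
    then obtain b where b: "b |\<in>| pos r" "b \<in> S" "Gap (head r) b \<notin> N"
      by auto
    \<comment> \<open>A \<open>Gap\<close> atom can fail merely because its body atom is false.
      Applicability excludes this, so the failure bounds the ranks.\<close>
    moreover have "Orig b \<in> N"
      using that(3) b by (auto simp: rank_applicable_def)
    ultimately have "?m (head r) \<le> Suc (?m b)"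
      using order(2)[OF that(1) b(2) that(2) b(1)] by (meson not_less)
    then show ?thesis
      using b False by (auto simp: tight_at_def)
  qed
  moreover have "a \<in> Orig -` N \<longleftrightarrow>
      (\<exists>r. r |\<in>| P \<and> head r = a \<and> rank_applicable S (Orig -` N) ?m r)" if "a \<in> S" for a
  proof -
    have "dl_sat N \<tau> (toc_support P a)"
      using assms that unfolding dl_models_def TOC_def by blast
    then show ?thesis
      using app that by (auto simp: toc_support_def Def_def)
  qed
  moreover have "1 \<le> ?m a \<and> ?m a \<le> card S + 1 \<and> (a \<notin> Orig -` N \<longrightarrow> ?m a = card S + 1)"
    if "a \<in> S" for a
    using range[OF that] by auto
  ultimately show "tight_ranking P S (Orig -` N) ?m"
    unfolding tight_ranking_def by blast
qed

lemma models_if_tight_ranking: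
  assumes "tight_ranking P S X m"
  obtains N \<tau> where "dl_models N \<tau> (TOC P S)" "Orig -` N = X"
    "\<tau> ZVar = 0" "\<And>a. \<tau> (XVar a) = int (m a)"
proof -
  \<comment> \<open>Each auxiliary atom gets the truth value of the right-hand side of its
    equivalence. What remains to be checked from the assumption are the range, support and tightness
    formulas.\<close>
  define N where "N = Orig ` X \<union> {Dep a b | a b. b \<in> X \<and> m b < m a}
     \<union> {Gap a b | a b. b \<in> X \<and> Suc (m b) < m a} \<union> {App r | r. rank_applicable S X m r}"
  define \<tau> where "\<tau> = (\<lambda>v. case v of ZVar \<Rightarrow> 0 | XVar a \<Rightarrow> int (m a))"
  have N: "Orig a \<in> N \<longleftrightarrow> a \<in> X" "Dep a b \<in> N \<longleftrightarrow> b \<in> X \<and> m b < m a"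
    "Gap a b \<in> N \<longleftrightarrow> b \<in> X \<and> Suc (m b) < m a" "App r \<in> N \<longleftrightarrow> rank_applicable S X m r" for a b r
    by (auto simp: N_def)
  have \<tau>: "\<tau> ZVar = 0" "\<tau> (XVar a) = int (m a)" for a
    by (auto simp: \<tau>_def)
  have "dl_sat N \<tau> \<phi>" if "a \<in> S" "\<phi> \<in> toc_range S a" for a \<phi>
    using that assms(1) by (auto simp: toc_range_def tight_ranking_def N \<tau>)
  moreover have "dl_sat N \<tau> \<phi>" if "\<phi> \<in> toc_order a b" for a b \<phi>
    using that by (auto simp: toc_order_def N \<tau>)
  moreover have "dl_sat N \<tau> (toc_support P a)" if "a \<in> S" for a
    using that assms(1) by (auto simp: toc_support_def tight_ranking_def Def_def N)
  moreover have "dl_sat N \<tau> (toc_app S a r)" if "r \<in> fset (Def a P)" for a r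
    using that by (auto simp: toc_app_def Def_def pos_in_def pos_out_def N rank_applicable_def)
  moreover have "dl_sat N \<tau> (toc_tight S a r)" if "a \<in> S" "r \<in> fset (Def a P)" for a r
  proof (cases "rank_applicable S X m r")
    case True
    then have "tight_at S m r"
      using that assms(1) by (auto simp: tight_ranking_def Def_def)
    then show ?thesis
      using that by (auto simp: toc_tight_def tight_at_def pos_in_def Def_def N \<tau> not_less
          split: if_splits)
  next
    case False
    then show ?thesis
      by (simp add: toc_tight_def N)
  qed
  ultimately have "dl_models N \<tau> (TOC P S)"
    unfolding dl_models_def TOC_def by blast
  moreover have "Orig -` N = X"
    using N(1) by auto
  ultimately show ?thesis
    using \<tau> that by blast
qed

section \<open>Stable models and tight rankings\<close>

text \<open>The rule deriving an atom at its level has its body one stage earlier, which gives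
  support. Conversely, an applicable rule derives its head one stage after its body is complete,
  which gives tightness.\<close>

lemma tight_ranking_if_stable_model:
  assumes stable: "stable_model P S I M" and "finite S"
  shows "tight_ranking P S M (\<lambda>a. if a \<in> M then level_rank P S I M a else card S + 1)"
proof -
  let ?T = "stage (reduct (module_of P S) M) I"
  let ?lev = "level_rank P S I M"
  let ?m = "\<lambda>a. if a \<in> M then ?lev a else card S + 1"
  have M: "M = (\<Union>i. ?T i)" and I_S: "I \<inter> S = {}"
    using stable by (auto simp: stable_model_def input_atoms_def)
  have lev: "1 \<le> ?lev a" "a \<in> ?T (?lev a)" if "a \<in> M" for a
    using that M level_rank_stage[where a = a] by blast+
  have support: "\<exists>r. r |\<in>| P \<and> head r = a \<and> rank_applicable S M ?m r" if "a \<in> M" "a \<in> S" for a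
  proof -
    from lev[OF \<open>a \<in> M\<close>] obtain i where i: "?lev a = Suc i"
      by (cases "?lev a") auto
    then have "a \<in> ?T (Suc i)"
      using lev[OF \<open>a \<in> M\<close>] by simp
    then obtain r where r: "r |\<in>| P" "head r = a" "fset (neg r) \<inter> M = {}" "fset (pos r) \<subseteq> ?T i"
      using I_S \<open>a \<in> S\<close> unfolding stage_reduct_Suc_iff by (auto simp: module_of_def)
    have "b \<in> M \<and> (b \<in> S \<longrightarrow> ?m b < ?m a)" if b: "b |\<in>| pos r" for b
    proof -
      have "b \<in> ?T i"
        using r b by blast
      then have "b \<in> M"
        using M by blast
      moreover have "?lev b < ?lev a" if "b \<in> S"
      proof -
        \<comment> \<open>Stage 0 holds only inputs, which lie outside \<open>S\<close>; hence
          \<open>i\<close> is a stage that counts for the level of \<open>b\<close>.\<close>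
        have "i \<noteq> 0"
          using that \<open>b \<in> ?T i\<close> I_S by (cases i) auto
        then show ?thesis
          using level_rank_le[OF \<open>b \<in> ?T i\<close>] i by simp
      qed
      ultimately show ?thesis
        using \<open>a \<in> M\<close> by simp
    qed
    then show ?thesis
      using r unfolding rank_applicable_def by blast
  qed
  \<comment> \<open>Tightness is stated for \<open>?lev\<close>, since \<open>?m\<close> agrees with
    it at the head only once the head is known to be in \<open>M\<close>.\<close>
  have closed: "head r \<in> M \<and> tight_at S ?lev r"
    if r: "r |\<in>| P" "head r \<in> S" and "rank_applicable S M ?m r" for r
  proof -
    have body: "fset (pos r) \<subseteq> M" "fset (neg r) \<inter> M = {}"
      using that by (auto simp: rank_applicable_def)
    \<comment> \<open>Body atoms outside \<open>S\<close> are inputs, present from stage 0 on, so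
      they never delay a derivation.\<close>
    have outside: "b \<in> ?T i" if "b |\<in>| pos r" "b \<notin> S" for b i
    proof -
      have "b \<in> ?T (?lev b)"
        using lev body that by blast
      then have "b \<in> ?T 0"
        using stage_module_outside that by fastforce
      then show ?thesis
        by (rule stage_mono) simp
    qed
    have derivable: "head r \<in> ?T (Suc i)" if "fset (pos r) \<subseteq> ?T i" for i
      using r body that unfolding stage_reduct_Suc_iff by (auto simp: module_of_def)
    show ?thesis
    proof (cases "fset (pos r) \<inter> S = {}")
      case True
      then have "head r \<in> ?T (Suc 0)"
        by (intro derivable) (use outside in blast)
      then show ?thesis
        using True M level_rank_le by (fastforce simp: tight_at_def simp del: stage.simps)
    next
      case False
      \<comment> \<open>The body is complete when its last atom of \<open>S\<close> appears, so an
        atom of maximal level is the witness for tightness.\<close>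
      then obtain b where b: "b \<in> fset (pos r) \<inter> S"
        and "?lev b = Max (?lev ` (fset (pos r) \<inter> S))"
        using Max_in[of "?lev ` (fset (pos r) \<inter> S)"] by fastforce
      then have max: "?lev b' \<le> ?lev b" if "b' \<in> fset (pos r) \<inter> S" for b'
        using that by simp
      have "fset (pos r) \<subseteq> ?T (?lev b)"
      proof
        fix c assume c: "c \<in> fset (pos r)"
        show "c \<in> ?T (?lev b)"
        proof (cases "c \<in> S")
          case True
          then show ?thesis
            using stage_mono[OF lev(2) max] body(1) c by blast
        next
          case False
          then show ?thesis
            using outside c by blast
        qed
      qed
      then have "head r \<in> ?T (Suc (?lev b))"
        by (rule derivable)
      moreover from this have "?lev (head r) \<le> Suc (?lev b)"
        by (rule level_rank_le) simp
      ultimately show ?thesis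
        using False b M by (auto simp: tight_at_def simp del: stage.simps)
    qed
  qed
  have tight: "tight_at S ?m r"
    if r: "r |\<in>| P" "head r \<in> S" and "rank_applicable S M ?m r" for r
  proof -
    have "fset (pos r) \<subseteq> M"
      using that by (auto simp: rank_applicable_def)
    then show ?thesis
      using closed[OF that] by (auto simp: tight_at_def split: if_splits)
  qed
  \<comment> \<open>Support puts the body atoms in \<open>S\<close> strictly below the head and
    tightness puts one of them at most one below; that one is exactly one below, so the levels have
    no gaps.\<close>
  have "?lev a \<le> card (M \<inter> S)" if "a \<in> M \<inter> S" for a
  proof (rule rank_le_card_if_gap_free)
    show "finite (M \<inter> S)"
      using \<open>finite S\<close> by simp
    show "\<exists>b\<in>M \<inter> S. ?lev a = Suc (?lev b)" if a: "a \<in> M \<inter> S" and "2 \<le> ?lev a" for a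
    proof -
      obtain r where r: "r |\<in>| P" "head r = a" "rank_applicable S M ?m r"
        using support a by blast
      then obtain b where "b |\<in>| pos r" "b \<in> S" "?lev a \<le> Suc (?lev b)"
        using closed[OF r(1) _ r(3)] a \<open>2 \<le> ?lev a\<close>
        by (auto simp: tight_at_def split: if_splits)
      moreover from this have "b \<in> M" "?lev b < ?lev a"
        using r a unfolding rank_applicable_def by force+
      ultimately show ?thesis
        by (intro bexI[of _ b]) auto
    qed
  qed (use that in simp)
  then have "?lev a \<le> card S" if "a \<in> M \<inter> S" for a
    using that card_mono[of S "M \<inter> S"] \<open>finite S\<close> by fastforce
  then show ?thesis
    unfolding tight_ranking_def using lev support closed tight by (auto simp: le_SucI)
qed

lemma stable_model_if_tight_ranking:
  assumes ranking: "tight_ranking P S X m" and "finite S"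
  defines "M \<equiv> X \<inter> At (module_of P S)"
  defines "I \<equiv> X \<inter> (At (module_of P S) - S)"
  shows "stable_model P S I M"
    and "\<And>a. a \<in> M \<inter> S \<Longrightarrow> level_rank P S I M a = m a"
proof -
  let ?T = "stage (reduct (module_of P S) M) I"
  have m_pos: "1 \<le> m a" and m_false: "a \<notin> X \<Longrightarrow> m a = card S + 1" if "a \<in> S" for a
    using ranking that by (auto simp: tight_ranking_def)
  have support: "\<exists>r. r |\<in>| P \<and> head r = a \<and> rank_applicable S X m r \<and> tight_at S m r"
    if "a \<in> X" "a \<in> S" for a
    using ranking that by (auto simp: tight_ranking_def)
  have closed: "head r \<in> X" "tight_at S m r"
    if "r |\<in>| P" "head r \<in> S" "rank_applicable S X m r" for r
    using ranking that by (auto simp: tight_ranking_def)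
  \<comment> \<open>\<open>X\<close> may contain atoms foreign to the module. As module rules
    mention module atoms only, their bodies have the same truth value in \<open>X\<close> and in
    \<open>M\<close>.\<close>
  have At: "head r \<in> At (module_of P S)" "fset (pos r) \<subseteq> At (module_of P S)"
    "fset (neg r) \<subseteq> At (module_of P S)" if "r |\<in>| P" "head r \<in> S" for r
    using that unfolding At_def module_of_def by fastforce+
  have "m a \<le> card (X \<inter> S)" if "a \<in> X \<inter> S" for a
  proof (rule rank_le_card_if_gap_free)
    show "finite (X \<inter> S)"
      using \<open>finite S\<close> by simp
    show "\<exists>b\<in>X \<inter> S. m a = Suc (m b)" if a: "a \<in> X \<inter> S" and "2 \<le> m a" for a
    proof -
      obtain r where r: "r |\<in>| P" "head r = a" "rank_applicable S X m r" "tight_at S m r"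
        using support a by blast
      then obtain b where "b |\<in>| pos r" "b \<in> S" "m a \<le> Suc (m b)"
        using \<open>2 \<le> m a\<close> by (auto simp: tight_at_def split: if_splits)
      moreover from this have "b \<in> X" "m b < m a"
        using r unfolding rank_applicable_def by force+
      ultimately show ?thesis
        by (intro bexI[of _ b]) auto
    qed
  qed (use that in simp)
  \<comment> \<open>This separates true atoms from false ones, whose rank is
    \<open>card S + 1\<close>.\<close>
  then have m_true: "m a \<le> card S" if "a \<in> X \<inter> S" for a
    using that card_mono[of S "X \<inter> S"] \<open>finite S\<close> by fastforce
  have stage_if_true: "a \<in> ?T (m a)" if "a \<in> X" "a \<in> S" for a
    using that
  proof (induction "m a" arbitrary: a rule: less_induct)
    case less
    obtain r where r: "r |\<in>| P" "head r = a" "rank_applicable S X m r"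
      using support less.prems by blast
    obtain i where i: "m a = Suc i"
      using m_pos[of a] less.prems by (cases "m a") auto
    have "fset (pos r) \<subseteq> ?T i"
    proof
      fix b assume b: "b \<in> fset (pos r)"
      show "b \<in> ?T i"
      proof (cases "b \<in> S")
        case True
        then have "b \<in> X" "m b < m a"
          using b r by (auto simp: rank_applicable_def)
        then show ?thesis
          using stage_mono[OF less.hyps[of b]] True i by simp
      next
        case False
        then have "b \<in> ?T 0"
          using b r At(2)[of r] less.prems by (auto simp: rank_applicable_def I_def)
        then show ?thesis
          by (rule stage_mono) simp
      qed
    qed
    moreover have "fset (neg r) \<inter> M = {}"
      using r by (auto simp: rank_applicable_def M_def)
    ultimately have "a \<in> ?T (Suc i)"
      using r less.prems unfolding stage_reduct_Suc_iff by (auto simp: module_of_def)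
    then show ?case
      using i by simp
  qed
  \<comment> \<open>Truth and rank bound need a joint induction: showing that the deriving rule
    applies uses both the truth and the ranks of its body atoms.\<close>
  have true_if_stage: "a \<in> M \<and> m a \<le> i" if "a \<in> ?T i" "a \<in> S" for a i
    using that
  proof (induction i arbitrary: a)
    case 0
    then show ?case
      by (simp add: I_def)
  next
    case (Suc i)
    then obtain r where r: "r |\<in>| P" "head r = a" "fset (neg r) \<inter> M = {}" "fset (pos r) \<subseteq> ?T i"
      unfolding stage_reduct_Suc_iff by (auto simp: module_of_def I_def)
    have inside: "b \<in> X \<and> m b \<le> i" if "b |\<in>| pos r" "b \<in> S" for b
      using Suc.IH[of b] r that by (auto simp: M_def)
    have "b \<in> X" if "b |\<in>| pos r" "b \<notin> S" for b
      using stage_module_outside r(4) that by (fastforce simp: I_def)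
    moreover have "fset (neg r) \<inter> X = {}"
      using r At(3)[of r] Suc.prems by (auto simp: M_def)
    ultimately have applicable: "rank_applicable S X m r"
      if "\<And>b. b |\<in>| pos r \<Longrightarrow> b \<in> S \<Longrightarrow> m b < m a"
      using that inside r unfolding rank_applicable_def by blast
    have "a \<in> X"
    proof (rule ccontr)
      assume "a \<notin> X"
      \<comment> \<open>A false head would have rank \<open>card S + 1\<close>, above every true
        body atom in \<open>S\<close>, so the rule would apply and make the head true.\<close>
      then have "rank_applicable S X m r"
        using m_false[of a] m_true inside Suc.prems by (intro applicable) (simp add: less_Suc_eq_le)
      then show False
        using closed(1)[of r] r Suc.prems \<open>a \<notin> X\<close> by blast
    qed
    \<comment> \<open>If all body atoms in \<open>S\<close> rank below \<open>a\<close>, the rule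
      applies and tightness yields the bound. Otherwise some body atom has rank at least
      \<open>m a\<close>, and its own bound \<open>i\<close> suffices.\<close>
    moreover have "m a \<le> Suc i"
    proof (cases "\<forall>b. b |\<in>| pos r \<longrightarrow> b \<in> S \<longrightarrow> m b < m a")
      case True
      then have "tight_at S m r"
        using closed(2)[of r] applicable r Suc.prems by blast
      then show ?thesis
        using inside r by (fastforce simp: tight_at_def split: if_splits)
    next
      case False
      then show ?thesis
        using inside by fastforce
    qed
    ultimately show ?case
      using At(1)[of r] r Suc.prems by (auto simp: M_def)
  qed
  have "M = (\<Union>i. ?T i)"
  proof
    show "M \<subseteq> (\<Union>i. ?T i)"
    proof
      fix a assume a: "a \<in> M"
      show "a \<in> (\<Union>i. ?T i)"
      proof (cases "a \<in> S")
        case True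
        then show ?thesis
          using a stage_if_true[of a] by (auto simp: M_def)
      next
        case False
        then have "a \<in> ?T 0"
          using a by (auto simp: M_def I_def)
        then show ?thesis
          by blast
      qed
    qed
    show "(\<Union>i. ?T i) \<subseteq> M"
      using true_if_stage stage_module_outside[of _ P S M I] by (fastforce simp: M_def I_def)
  qed
  then show "stable_model P S I M"
    by (auto simp: stable_model_def input_atoms_def M_def I_def)
  show "level_rank P S I M a = m a" if "a \<in> M \<inter> S" for a
  proof (rule antisym)
    have a: "a \<in> X" "a \<in> S"
      using that by (auto simp: M_def)
    then show "level_rank P S I M a \<le> m a"
      by (intro level_rank_le stage_if_true m_pos)
    show "m a \<le> level_rank P S I M a"
      using true_if_stage[OF level_rank_stage(2)[OF stage_if_true[OF a]]] a by blast
  qed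
qed

theorem theorem1:
  fixes P :: "'a program" and S :: "'a set"
  assumes "is_scc P S"
  shows
    "(\<forall>I M. stable_model P S I M \<longrightarrow>
        (\<exists>N \<tau>. dl_models N \<tau> (TOC P S) \<and> \<tau> ZVar = 0 \<and>
           M = Orig -` N \<inter> At (module_of P S) \<and>
           (\<forall>a\<in>M \<inter> S. \<tau> (XVar a) = int (level_rank P S I M a)) \<and>
           (\<forall>a\<in>S - M. \<tau> (XVar a) = int (card S) + 1)))
     \<and>
     (\<forall>N \<tau>. dl_models N \<tau> (TOC P S) \<longrightarrow>
        (let M = Orig -` N \<inter> At (module_of P S);
             I = Orig -` N \<inter> (At (module_of P S) - S)
         in stable_model P S I M \<and>
            (\<forall>a\<in>M \<inter> S. int (level_rank P S I M a) = \<tau> (XVar a) - \<tau> ZVar)))"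
proof (intro conjI allI impI)
  \<comment> \<open>The counting arguments need \<open>S\<close> to be finite, which it is as a set
    of atoms of a finite program.\<close>
  have "S \<subseteq> At P"
    using assms by (simp add: is_scc_def strongly_connected_def)
  then have "finite S"
    using finite_At finite_subset by blast
  {
    fix I M assume stable: "stable_model P S I M"
    obtain N \<tau> where "dl_models N \<tau> (TOC P S)" "Orig -` N = M" "\<tau> ZVar = 0"
      "\<And>a. \<tau> (XVar a) = int (if a \<in> M then level_rank P S I M a else card S + 1)"
      using models_if_tight_ranking[OF tight_ranking_if_stable_model[OF stable \<open>finite S\<close>]]
      by blast
    moreover have "M \<subseteq> At (module_of P S)"
      using stable by (simp add: stable_model_def)
    ultimately show "\<exists>N \<tau>. dl_models N \<tau> (TOC P S) \<and> \<tau> ZVar = 0 \<and>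
           M = Orig -` N \<inter> At (module_of P S) \<and>
           (\<forall>a\<in>M \<inter> S. \<tau> (XVar a) = int (level_rank P S I M a)) \<and>
           (\<forall>a\<in>S - M. \<tau> (XVar a) = int (card S) + 1)"
      by (intro exI[of _ N] exI[of _ \<tau>]) auto
  }
  fix N \<tau> assume "dl_models N \<tau> (TOC P S)"
  note ranking = tight_ranking_if_models[OF this]
  show "let M = Orig -` N \<inter> At (module_of P S);
             I = Orig -` N \<inter> (At (module_of P S) - S)
         in stable_model P S I M \<and>
            (\<forall>a\<in>M \<inter> S. int (level_rank P S I M a) = \<tau> (XVar a) - \<tau> ZVar)"
    using stable_model_if_tight_ranking[OF ranking(1) \<open>finite S\<close>] ranking(2)
    by (simp add: Let_def less_imp_le)
qed

end
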